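(* Let $p\ge 1$, let $\Xi=\Xi_1\times\cdots\times\Xi_n$ be a Polish product space with metric $\rho$ on $\Xi$ and metrics $\rho_k$ on $\Xi_k$, $k\in[n]$, and let $\xi=(\xi_1,\ldots,\xi_n)$ be a $\Xi$-valued random variable whose components $\xi_1,\ldots,\xi_n$ are independent and whose distribution $P_\xi$ belongs to $\mathcal P_p(\Xi)$. Let $P_{\xi_k}$ denote the distribution of $\xi_k$. Given i.i.d. samples $\xi^1,\ldots,\xi^N$ of $\xi$, let $P_{\xi_k}^N:=\frac1N\sum_{i=1}^N\delta_{\xi_k^i}$, $k\in[n]$, be the empirical distributions of the individual components. Let $\varepsilon_k>0$ and $\beta_k\in[0,1]$, $k\in[n]$, and assume that for each $k\in[n]$ the Wasserstein ball $\mathcal B_p(P_{\xi_k}^N,\varepsilon_k)$ contains $P_{\xi_k}$ with confidence $1-\beta_k$, i.e., $\mathbb P\big(P_{\xi_k}\in\mathcal B_p(P_{\xi_k}^N,\varepsilon_k)\big)\ge 1-\beta_k$. Then the Wasserstein hyperrectangle $\mathcal H_p(\boldsymbol P_\xi^N,\boldsymbol\varepsilon)$ contains $P_\xi$ with confidence $\prod_{k=1}^n(1-\beta_k)$, i.e., $$\mathbb P\big(P_\xi\in\mathcal H_p(\boldsymbol P_\xi^N,\boldsymbol\varepsilon)\big)\ge\prod_{k=1}^n(1-\beta_k).$$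
   Context: $[n]=\{1,\ldots,n\}$. A Polish space is a complete separable metric space, with its Borel $\sigma$-algebra; $\Xi$ carries the product topology, metrized by $\rho$. $\mathcal P(S)$ is the set of Borel probability measures on a Polish space $S$, and $\mathcal P_p(S)$ the subset with finite $p$th moment. For a Polish space $(S,d)$ and $Q,P\in\mathcal P_p(S)$, $W_p(Q,P):=\big(\inf_{\pi\in\mathcal C(Q,P)}\int_{S\times S}d(\zeta,\xi)^p\,d\pi(\zeta,\xi)\big)^{1/p}$, where $\mathcal C(Q,P)$ is the set of probability measures on $S\times S$ with first marginal $Q$ and second marginal $P$. The Wasserstein ball is $\mathcal B_p(Q,\varepsilon):=\{P\in\mathcal P_p(S):W_p(Q,P)\le\varepsilon\}$ (on $\Xi_k$ the metric $\rho_k$ is used). With $\boldsymbol\varepsilon=(\varepsilon_1,\ldots,\varepsilon_n)$ and the product empirical distribution $\boldsymbol P_\xi^N:=P_{\xi_1}^N\otimes\cdots\otimes P_{\xi_n}^N$, the Wasserstein hyperrectangle is $$\mathcal H_p(\boldsymbol P_\xi^N,\boldsymbol\varepsilon):=\{P_1'\otimes\cdots\otimes P_n':P_k'\in\mathcal B_p(P_{\xi_k}^N,\varepsilon_k)\text{ for all }k\in[n]\}.$$ Here $\xi_k^i$ denotes the $k$th component of the sample $\xi^i$. *)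

theory Defs
  imports "HOL-Probability.Probability"
begin

text \<open>
  The factors of a finite product may be arbitrary, pairwise different Polish spaces. They are
  therefore given as carrier-based metric spaces (type \<^typ>\<open>'a metric\<close>) inside one ambient type,
  and the product lives on extensional functions, as in \<^const>\<open>product_topology\<close> and \<^const>\<open>PiM\<close>.
\<close>

definition polish_metric :: "'a metric \<Rightarrow> bool" where
  "polish_metric S \<longleftrightarrow> mcomplete_of S \<and> separable_space (mtopology_of S)"

definition borel_of :: "'a topology \<Rightarrow> 'a measure" where
  "borel_of T = sigma (topspace T) {U. openin T U}"

definition borel_probs :: "'a topology \<Rightarrow> 'a measure set" where
  "borel_probs T = {P. prob_space P \<and> sets P = sets (borel_of T)}"

definition borel_probs_moment :: "real \<Rightarrow> 'a metric \<Rightarrow> 'a measure set" where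
  "borel_probs_moment p S = {P \<in> borel_probs (mtopology_of S).
     \<exists>\<zeta>\<in>mspace S. (\<integral>\<^sup>+ \<xi>. ennreal (mdist S \<zeta> \<xi> powr p) \<partial>P) < \<infinity>}"

definition couplings :: "'a metric \<Rightarrow> 'a measure \<Rightarrow> 'a measure \<Rightarrow> ('a \<times> 'a) measure set" where
  "couplings S Q P = {\<pi> \<in> borel_probs (prod_topology (mtopology_of S) (mtopology_of S)).
     distr \<pi> (borel_of (mtopology_of S)) fst = Q \<and>
     distr \<pi> (borel_of (mtopology_of S)) snd = P}"

text \<open>
  The infimum is taken in \<^typ>\<open>ennreal\<close> and is finite for \<open>Q\<close>, \<open>P\<close> with finite \<open>p\<close>th moment,
  the only arguments for which the distance is meant to be used (\<^const>\<open>enn2real\<close> sends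
  \<open>\<infinity>\<close> to \<open>0\<close>).
\<close>

definition wasserstein :: "real \<Rightarrow> 'a metric \<Rightarrow> 'a measure \<Rightarrow> 'a measure \<Rightarrow> real" where
  "wasserstein p S Q P =
     enn2real (INF \<pi>\<in>couplings S Q P.
       \<integral>\<^sup>+ z. ennreal (mdist S (fst z) (snd z) powr p) \<partial>\<pi>) powr (1 / p)"

definition wasserstein_ball :: "real \<Rightarrow> 'a metric \<Rightarrow> 'a measure \<Rightarrow> real \<Rightarrow> 'a measure set" where
  "wasserstein_ball p S Q \<epsilon> = {P \<in> borel_probs_moment p S. wasserstein p S Q P \<le> \<epsilon>}"

definition empirical_measure :: "'a measure \<Rightarrow> nat \<Rightarrow> (nat \<Rightarrow> 'a) \<Rightarrow> 'a measure" where
  "empirical_measure B N x =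
     measure_of (space B) (sets B) (\<lambda>A. (\<Sum>i=1..N. emeasure (return B (x i)) A) / of_nat N)"

text \<open>
  The centre, a product measure on the factors \<open>S k\<close> with \<open>1 \<le> k \<le> n\<close>, is represented by the
  family \<open>Q\<close> of its marginals.
\<close>

definition wasserstein_hyperrectangle ::
  "real \<Rightarrow> nat \<Rightarrow> (nat \<Rightarrow> 'a metric) \<Rightarrow> (nat \<Rightarrow> 'a measure) \<Rightarrow> (nat \<Rightarrow> real)
    \<Rightarrow> (nat \<Rightarrow> 'a) measure set" where
  "wasserstein_hyperrectangle p n S Q \<epsilon> =
     {PiM {1..n} P' | P'. \<forall>k\<in>{1..n}. P' k \<in> wasserstein_ball p (S k) (Q k) (\<epsilon> k)}"

end

theory Submission
  imports Defs
begin

text \<open>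
  The event that the ball around the \<open>k\<close>th empirical measure contains the true marginal depends only on
  the \<open>k\<close>th components of the samples, and these column vectors are independent in \<open>k\<close>; a product measure
  determines its factors, so the hyperrectangle event is the intersection of the \<open>n\<close> ball events. The
  point is that each ball event is given by a Borel set of sample vectors: moving the atoms of an
  empirical measure by at most \<open>\<delta>\<close> turns a coupling with cost integrand \<open>d\<^sup>p\<close> into one whose cost is at most
  the integral of \<open>(\<delta> + d)\<^sup>p\<close>, so the optimal transport cost is upper semicontinuous in the atoms.
\<close>

section \<open>Borel sigma-algebras of metric topologies and of finite products\<close>

lemma space_borel_of [simp]: "space (borel_of T) = topspace T"
  by (simp add: borel_of_def space_measure_of_conv)

lemma sets_borel_of: "sets (borel_of T) = sigma_sets (topspace T) {U. openin T U}"
  unfolding borel_of_def by (rule sets_measure_of) (auto dest: openin_subset)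

lemma openin_in_sets_borel_of: "openin T U \<Longrightarrow> U \<in> sets (borel_of T)"
  by (auto simp: sets_borel_of)

lemma closedin_in_sets_borel_of:
  assumes "closedin T C"
  shows "C \<in> sets (borel_of T)"
proof -
  have "topspace T - (topspace T - C) \<in> sets (borel_of T)"
    using assms sets.compl_sets[OF openin_in_sets_borel_of[of T "topspace T - C"]]
    by (simp add: closedin_def)
  then show ?thesis
    using assms by (simp add: closedin_def double_diff)
qed

lemma continuous_map_measurable_borel_of:
  assumes "continuous_map T T' f"
  shows "f \<in> measurable (borel_of T) (borel_of T')"
proof (rule measurable_sigma_sets[OF sets_borel_of])
  fix U assume "U \<in> {U. openin T' U}"
  then have "openin T {x \<in> topspace T. f x \<in> U}"
    using assms by (auto simp: continuous_map_def)
  moreover have "{x \<in> topspace T. f x \<in> U} = f -` U \<inter> space (borel_of T)"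
    by auto
  ultimately show "f -` U \<inter> space (borel_of T) \<in> sets (borel_of T)"
    by (metis openin_in_sets_borel_of)
qed (use assms in \<open>auto dest: openin_subset simp: continuous_map_def\<close>)

lemma continuous_map_borel_measurable:
  fixes f :: "'a \<Rightarrow> real"
  assumes "continuous_map T euclidean f"
  shows "f \<in> borel_measurable (borel_of T)"
proof (rule borel_measurableI)
  fix S :: "real set" assume "open S"
  then have "openin T {x \<in> topspace T. f x \<in> S}"
    using assms by (auto simp: continuous_map_def)
  moreover have "{x \<in> topspace T. f x \<in> S} = f -` S \<inter> space (borel_of T)"
    by auto
  ultimately show "f -` S \<inter> space (borel_of T) \<in> sets (borel_of T)"
    by (metis openin_in_sets_borel_of)
qed

lemma mdist_same [simp]: "x \<in> mspace S \<Longrightarrow> mdist S x x = 0"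
  by simp

lemma openin_mball_of [simp]: "openin (mtopology_of S) (mball_of S x r)"
  by (simp add: mtopology_of_def mball_of_def Metric_space.openin_mball)

lemma openin_mtopology_of_ball:
  assumes "openin (mtopology_of S) U" "x \<in> U"
  obtains r where "0 < r" "mball_of S x r \<subseteq> U"
  using assms by (auto simp: mtopology_of_def mball_of_def Metric_space.openin_mtopology)

lemma singleton_in_sets_borel_of_metric:
  assumes "x \<in> mspace S"
  shows "{x} \<in> sets (borel_of (mtopology_of S))"
proof (rule closedin_in_sets_borel_of)
  have "Hausdorff_space (mtopology_of S)"
    by (simp add: mtopology_of_def Metric_space.Hausdorff_space_mtopology)
  then show "closedin (mtopology_of S) {x}"
    by (simp add: closedin_Hausdorff_singleton assms)
qed

text \<open>The balls of radius \<open>1 / (m + 1)\<close> around the points of a countable dense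
  set form a base: inside a ball of radius \<open>r\<close> around \<open>x\<close>, a dense point
  \<open>c\<close> closer to \<open>x\<close> than such a radius below \<open>r / 2\<close> has a
  ball that contains \<open>x\<close> and stays inside.\<close>

lemma separable_metric_imp_second_countable:
  assumes "separable_space (mtopology_of S)"
  shows "second_countable (mtopology_of S)"
proof -
  obtain C where C: "countable C" "C \<subseteq> mspace S" "mtopology_of S closure_of C = mspace S"
    using assms by (auto simp: separable_space_def)
  define \<B> where "\<B> = (\<lambda>(c, m). mball_of S c (1 / real (Suc m))) ` (C \<times> UNIV)"
  have "\<exists>V\<in>\<B>. x \<in> V \<and> V \<subseteq> U" if U: "openin (mtopology_of S) U" "x \<in> U" for U x
  proof -
    obtain r where r: "0 < r" "mball_of S x r \<subseteq> U"
      using openin_mtopology_of_ball[OF U] .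
    have x: "x \<in> mspace S"
      using openin_subset[OF U(1)] U(2) by auto
    obtain m where m: "1 / real (Suc m) < r / 2"
      using r(1) nat_approx_posE[of "r / 2"] by auto
    have "x \<in> mtopology_of S closure_of C" using C x by simp
    moreover have "x \<in> mball_of S x (1 / real (Suc m))"
      using x by simp
    ultimately obtain c where c: "c \<in> C" "c \<in> mball_of S x (1 / real (Suc m))"
      unfolding in_closure_of by (meson openin_mball_of)
    have "mball_of S c (1 / real (Suc m)) \<subseteq> mball_of S x r"
    proof
      fix y assume y: "y \<in> mball_of S c (1 / real (Suc m))"
      then have "mdist S x y \<le> mdist S x c + mdist S c y"
        using x c C by (auto intro: mdist_triangle)
      also have "\<dots> < r" using y c m by auto
      finally show "y \<in> mball_of S x r" using y x by auto
    qed
    moreover have "x \<in> mball_of S c (1 / real (Suc m))"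
      using c x by (auto simp: mdist_commute)
    moreover have "mball_of S c (1 / real (Suc m)) \<in> \<B>"
      using c by (auto simp: \<B>_def)
    ultimately show ?thesis using r by blast
  qed
  moreover have "countable \<B>"
    using C by (auto simp: \<B>_def)
  moreover have "\<forall>V\<in>\<B>. openin (mtopology_of S) V"
    by (auto simp: \<B>_def)
  ultimately show ?thesis
    unfolding second_countable_def by blast
qed

text \<open>Continuity of the projections gives one inclusion. For the other, every open set is the
  union of the boxes inside it whose sides are basic sets; finiteness of \<open>I\<close> makes
  these boxes measurable and countable in number.\<close>

lemma sets_borel_of_product_topology:
  assumes I: "finite I" and T: "\<And>i. i \<in> I \<Longrightarrow> second_countable (T i)"
  shows "sets (borel_of (product_topology T I)) = sets (PiM I (\<lambda>i. borel_of (T i)))"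
proof
  let ?P = "PiM I (\<lambda>i. borel_of (T i))" and ?X = "product_topology T I"
  \<comment> \<open>This is the identity map, eta-expanded so that measurability into
    \<open>?P\<close> reduces to the coordinates.\<close>
  have "(\<lambda>x i. x i) \<in> measurable (borel_of ?X) ?P"
    by (rule measurable_PiM_single')
       (auto intro: continuous_map_measurable_borel_of continuous_map_product_projection)
  then show "sets ?P \<subseteq> sets (borel_of ?X)"
  proof (intro subsetI)
    fix A assume A: "A \<in> sets ?P"
    from measurable_sets[OF \<open>(\<lambda>x i. x i) \<in> measurable (borel_of ?X) ?P\<close> A]
    show "A \<in> sets (borel_of ?X)"
      using sets.sets_into_space[OF A] by (simp add: space_PiM Int_absorb2)
  qed
  have "\<exists>B. countable B \<and> (\<forall>V\<in>B. openin (T i) V) \<and>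
      (\<forall>U x. openin (T i) U \<and> x \<in> U \<longrightarrow> (\<exists>V\<in>B. x \<in> V \<and> V \<subseteq> U))" if "i \<in> I" for i
    using T[OF that] by (simp add: second_countable_def)
  then obtain B where B: "\<And>i. i \<in> I \<Longrightarrow> countable (B i)"
    "\<And>i V. i \<in> I \<Longrightarrow> V \<in> B i \<Longrightarrow> openin (T i) V"
    "\<And>i U x. i \<in> I \<Longrightarrow> openin (T i) U \<Longrightarrow> x \<in> U \<Longrightarrow> \<exists>V\<in>B i. x \<in> V \<and> V \<subseteq> U"
    by metis
  have "U \<in> sets ?P" if U: "openin ?X U" for U
  proof -
    define F where "F = {V \<in> Pi\<^sub>E I B. Pi\<^sub>E I V \<subseteq> U}"
    have "U = (\<Union>V\<in>F. Pi\<^sub>E I V)"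
    proof
      show "U \<subseteq> (\<Union>V\<in>F. Pi\<^sub>E I V)"
      proof
        fix x assume "x \<in> U"
        then obtain W where W: "\<And>i. i \<in> I \<Longrightarrow> openin (T i) (W i)" "x \<in> Pi\<^sub>E I W" "Pi\<^sub>E I W \<subseteq> U"
          using U unfolding openin_product_topology_alt by metis
        have "\<exists>V\<in>B i. x i \<in> V \<and> V \<subseteq> W i" if "i \<in> I" for i
          using B(3)[OF that W(1)[OF that]] W(2) that by (auto simp: PiE_iff)
        then obtain V where V: "\<And>i. i \<in> I \<Longrightarrow> V i \<in> B i \<and> x i \<in> V i \<and> V i \<subseteq> W i"
          by metis
        \<comment> \<open>\<open>F\<close> contains only extensional families, which is what makes
          it countable; hence the chosen family is restricted to \<open>I\<close>.\<close>
        have "Pi\<^sub>E I (restrict V I) \<subseteq> Pi\<^sub>E I W"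
          using V by (intro PiE_mono) auto
        then have "restrict V I \<in> F"
          using V W by (auto simp: F_def)
        moreover have "x \<in> Pi\<^sub>E I (restrict V I)"
          using V W by (auto simp: PiE_iff)
        ultimately show "x \<in> (\<Union>V\<in>F. Pi\<^sub>E I V)" by blast
      qed
    qed (auto simp: F_def)
    moreover have "countable F"
      unfolding F_def using countable_PiE[OF I B(1)] by auto
    moreover have "Pi\<^sub>E I V \<in> sets ?P" if "V \<in> F" for V
      using that I B(2) by (intro sets_PiM_I_finite) (auto simp: F_def intro: openin_in_sets_borel_of)
    ultimately show ?thesis
      using sets.countable_UN'[of F "Pi\<^sub>E I" ?P] by auto
  qed
  moreover have "topspace ?X = space ?P"
    by (simp add: space_PiM)
  ultimately show "sets (borel_of ?X) \<subseteq> sets ?P"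
    by (auto simp: sets_borel_of intro!: sets.sigma_sets_subset)
qed

section \<open>Empirical measures as laws of a uniformly drawn index\<close>

text \<open>Drawing an index uniformly and reading off \<open>x\<close> hits \<open>A\<close> with
  the relative frequency of the sample in \<open>A\<close>. In this form countable additivity is
  automatic, and integrals follow from the transformation rule for \<open>distr\<close>.\<close>

lemma empirical_measure_eq_distr:
  assumes N: "1 \<le> N" and x: "\<And>i. i \<in> {1..N} \<Longrightarrow> x i \<in> space B"
  shows "empirical_measure B N x = distr (uniform_count_measure {1..N}) B x"
proof -
  let ?D = "distr (uniform_count_measure {1..N}) B x"
  have m: "x \<in> measurable (uniform_count_measure {1..N}) B"
    using x by (auto simp: measurable_def sets_uniform_count_measure space_uniform_count_measure)
  have "(\<Sum>i=1..N. emeasure (return B (x i)) A) / of_nat N = emeasure ?D A" if "A \<in> sets B" for A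
  proof -
    have "emeasure ?D A = of_nat (card (x -` A \<inter> {1..N})) / of_nat N"
      using N by (subst emeasure_distr[OF m that], simp only: space_uniform_count_measure,
          subst emeasure_uniform_count_measure)
        (auto simp: divide_ennreal ennreal_of_nat_eq_real_of_nat)
    also have "of_nat (card (x -` A \<inter> {1..N})) = (\<Sum>i=1..N. indicator A (x i) :: ennreal)"
      by (simp add: indicator_def sum.If_cases Int_def vimage_def conj_commute)
    finally show ?thesis using that by simp
  qed
  then have "empirical_measure B N x = measure_of (space B) (sets B) (emeasure ?D)"
    unfolding empirical_measure_def
    by (intro measure_of_eq) (auto simp: sets.space_closed sets.sigma_sets_eq)
  also have "\<dots> = ?D"
    using measure_of_of_measure[of ?D] by simp
  finally show ?thesis .
qed

lemma nn_integral_empirical_measure: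
  assumes N: "1 \<le> N" and x: "\<And>i. i \<in> {1..N} \<Longrightarrow> x i \<in> space B" and f: "f \<in> borel_measurable B"
  shows "(\<integral>\<^sup>+ a. f a \<partial>empirical_measure B N x) = (\<Sum>i=1..N. f (x i) / of_nat N)"
proof -
  have m: "x \<in> measurable (uniform_count_measure {1..N}) B"
    using x by (auto simp: measurable_def sets_uniform_count_measure space_uniform_count_measure)
  have eq: "empirical_measure B N x = distr (uniform_count_measure {1..N}) B x"
    using N x by (rule empirical_measure_eq_distr)
  have "ennreal (1 / real N) = 1 / of_nat N"
    using N by (simp add: ennreal_of_nat_eq_real_of_nat divide_ennreal flip: ennreal_1)
  then show ?thesis
    unfolding eq using f
    by (subst nn_integral_distr[OF m])
      (auto simp: uniform_count_measure_def nn_integral_point_measure_finite ennreal_divide_times simp del: One_nat_def)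
qed

lemma sets_empirical_measure [simp]: "sets (empirical_measure B N x) = sets B"
  by (simp add: empirical_measure_def sets.space_closed sets.sigma_sets_eq)

lemma AE_empirical_measure:
  assumes N: "1 \<le> N" and x: "\<And>i. i \<in> {1..N} \<Longrightarrow> x i \<in> space B"
    and s: "\<And>i. i \<in> {1..N} \<Longrightarrow> {x i} \<in> sets B"
  shows "AE a in empirical_measure B N x. a \<in> x ` {1..N}"
proof -
  have "(\<Union>i\<in>{1..N}. {x i}) \<in> sets B"
    using s by (intro sets.finite_UN) auto
  moreover have "(\<Union>i\<in>{1..N}. {x i}) = {a \<in> space B. a \<in> x ` {1..N}}"
    using x by auto
  ultimately have *: "{a \<in> space B. a \<in> x ` {1..N}} \<in> sets B"
    by simp
  have m: "x \<in> measurable (uniform_count_measure {1..N}) B"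
    using x by (auto simp: measurable_def sets_uniform_count_measure space_uniform_count_measure)
  have eq: "empirical_measure B N x = distr (uniform_count_measure {1..N}) B x"
    using N x by (rule empirical_measure_eq_distr)
  show ?thesis
    unfolding eq AE_distr_iff[OF m *]
    unfolding uniform_count_measure_def AE_point_measure by blast
qed

section \<open>Moving the atoms of an empirical measure inside a coupling\<close>

text \<open>
  Disintegrating a coupling of an empirical measure over the sample points amounts to distributing the
  mass over an atom evenly among the indices \<open>i\<close> that produce this atom.
\<close>

definition atom_weight :: "nat \<Rightarrow> (nat \<Rightarrow> 'a) \<Rightarrow> nat \<Rightarrow> 'a \<Rightarrow> ennreal" where
  "atom_weight N x i a = indicator {x i} a / of_nat (card {j\<in>{1..N}. x j = x i})"

text \<open>The indices that produce \<open>a\<close> share its mass evenly, so the weights form a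
  partition of unity on the sample points.\<close>

lemma sum_atom_weight:
  assumes "a \<in> x ` {1..N}"
  shows "(\<Sum>i=1..N. atom_weight N x i a) = 1"
proof -
  let ?J = "{j\<in>{1..N}. x j = a}"
  have c: "card ?J \<noteq> 0" using assms by auto
  have "(\<Sum>i=1..N. atom_weight N x i a) = (\<Sum>i=1..N. if x i = a then 1 / of_nat (card ?J) else 0)"
    by (intro sum.cong) (auto simp: atom_weight_def)
  also have "\<dots> = of_nat (card ?J) * (1 / of_nat (card ?J))"
    by (simp add: sum.If_cases Int_def conj_commute)
  also have "\<dots> = 1"
    using c by (simp add: ennreal_times_divide ennreal_divide_self of_nat_less_top del: One_nat_def card_eq_0_iff)
  finally show ?thesis .
qed

text \<open>The weights are symmetric: index \<open>i\<close> at the point \<open>x j\<close> has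
  the weight of index \<open>j\<close> at \<open>x i\<close>, because both vanish unless
  \<open>x i = x j\<close> and then have the same denominator.\<close>

lemma sum_atom_weight_sample:
  assumes "i \<in> {1..N}"
  shows "(\<Sum>j=1..N. atom_weight N x i (x j)) = 1"
proof -
  have "(\<Sum>j=1..N. atom_weight N x i (x j)) = (\<Sum>j=1..N. atom_weight N x j (x i))"
    by (intro sum.cong refl) (auto simp: atom_weight_def indicator_def)
  then show ?thesis using sum_atom_weight[of "x i" x N] assms by simp
qed

text \<open>For a coupling \<open>\<pi>\<close> of the empirical measure at \<open>x\<close>: draw
  \<open>z\<close> from \<open>\<pi>\<close>, split its mass among the indices \<open>i\<close> with
  \<open>x i = fst z\<close>, put \<open>y i\<close> in the first coordinate and keep the second.
  The density against a counting measure takes the place of a conditional kernel of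
  \<open>\<pi>\<close>.\<close>

definition move_atoms :: "'a metric \<Rightarrow> nat \<Rightarrow> (nat \<Rightarrow> 'a) \<Rightarrow> (nat \<Rightarrow> 'a) \<Rightarrow> ('a \<times> 'a) measure \<Rightarrow> ('a \<times> 'a) measure"
  where "move_atoms S N x y \<pi> =
    distr (density (\<pi> \<Otimes>\<^sub>M count_space {1..N}) (\<lambda>(z, i). atom_weight N x i (fst z)))
      (borel_of (prod_topology (mtopology_of S) (mtopology_of S))) (\<lambda>(z, i). (y i, snd z))"

context
  fixes S :: "'a metric" and N :: nat and x y :: "nat \<Rightarrow> 'a" and \<pi> :: "('a \<times> 'a) measure"
    and T TT
  defines "T \<equiv> mtopology_of S" and "TT \<equiv> prod_topology (mtopology_of S) (mtopology_of S)"
  assumes N: "1 \<le> N"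
    and x: "\<And>i. i \<in> {1..N} \<Longrightarrow> x i \<in> mspace S" and y: "\<And>i. i \<in> {1..N} \<Longrightarrow> y i \<in> mspace S"
    and sets_\<pi> [measurable_cong]: "sets \<pi> = sets (borel_of TT)"
begin

lemma measurable_fst_snd [measurable]:
  "fst \<in> measurable (borel_of TT) (borel_of T)" "snd \<in> measurable (borel_of TT) (borel_of T)"
  by (auto simp: TT_def T_def intro!: continuous_map_measurable_borel_of continuous_map_fst continuous_map_snd)

lemma measurable_move [measurable]:
  assumes "i \<in> {1..N}"
  shows "(\<lambda>z. (y i, snd z)) \<in> measurable (borel_of TT) (borel_of TT)"
  using y[OF assms]
  by (auto simp: TT_def intro!: continuous_map_measurable_borel_of continuous_map_pairedI continuous_map_snd)

lemma measurable_atom_weight [measurable]: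
  assumes "i \<in> {1..N}"
  shows "atom_weight N x i \<in> borel_measurable (borel_of T)"
  unfolding atom_weight_def[abs_def] T_def
  using singleton_in_sets_borel_of_metric[OF x[OF assms]]
  by (intro borel_measurable_divide_ennreal borel_measurable_indicator) auto

text \<open>Tonelli turns the integral over the discrete index into a finite sum. Both marginals and
  the cost of the moved coupling are computed from this formula.\<close>

lemma nn_integral_move_atoms:
  assumes h [measurable]: "h \<in> borel_measurable (borel_of TT)"
  shows "(\<integral>\<^sup>+ z. h z \<partial>move_atoms S N x y \<pi>)
    = (\<integral>\<^sup>+ z. (\<Sum>i=1..N. atom_weight N x i (fst z) * h (y i, snd z)) \<partial>\<pi>)"
proof -
  interpret C: sigma_finite_measure "count_space {1..N}"
    by (simp add: sigma_finite_measure_count_space_finite)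
  have move: "(\<lambda>(z, i). (y i, snd z)) \<in> measurable (\<pi> \<Otimes>\<^sub>M count_space {1..N}) (borel_of TT)"
    \<comment> \<open>The index is discrete, so measurability for each fixed \<open>i\<close> in
      \<open>{1..N}\<close> suffices.\<close>
    using measurable_compose_countable'[where f = "\<lambda>i (z, _). (y i, snd z)" and g = snd and I = "{1..N}"
      and M = "\<pi> \<Otimes>\<^sub>M count_space {1..N}" and N = "borel_of TT"]
    by (simp add: case_prod_unfold del: One_nat_def)
  have weight: "(\<lambda>(z, i). atom_weight N x i (fst z)) \<in> borel_measurable (\<pi> \<Otimes>\<^sub>M count_space {1..N})"
    using measurable_compose_countable'[where f = "\<lambda>i (z, _). atom_weight N x i (fst z)" and g = snd and I = "{1..N}"
      and M = "\<pi> \<Otimes>\<^sub>M count_space {1..N}" and N = borel]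
    by (simp add: case_prod_unfold del: One_nat_def)
  have "(\<integral>\<^sup>+ z. h z \<partial>move_atoms S N x y \<pi>) = (\<integral>\<^sup>+ w. (\<lambda>(z, i). atom_weight N x i (fst z)) w
      * h ((\<lambda>(z, i). (y i, snd z)) w) \<partial>(\<pi> \<Otimes>\<^sub>M count_space {1..N}))"
    unfolding move_atoms_def TT_def[symmetric]
    using move h by (subst nn_integral_distr)
      (simp_all only: measurable_density_eq1 measurable_distr_eq1 nn_integral_density[OF weight measurable_compose[OF move h]])
  also have "\<dots> = (\<integral>\<^sup>+ z. (\<Sum>i=1..N. atom_weight N x i (fst z) * h (y i, snd z)) \<partial>\<pi>)"
    using borel_measurable_times_ennreal[OF weight measurable_compose[OF move h]]
    by (subst C.nn_integral_fst[symmetric]) (auto simp: nn_integral_count_space_finite simp del: One_nat_def)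
  finally show ?thesis .
qed

context
  fixes P
  assumes \<pi>: "\<pi> \<in> couplings S (empirical_measure (borel_of T) N x) P"
begin

lemma fst_marginal: "distr \<pi> (borel_of T) fst = empirical_measure (borel_of T) N x"
  and snd_marginal: "distr \<pi> (borel_of T) snd = P"
  and prob_\<pi>: "prob_space \<pi>"
  using \<pi> by (auto simp: couplings_def borel_probs_def T_def)

text \<open>The first marginal is concentrated on the sample. This makes the weights sum to one
  almost everywhere under \<open>\<pi>\<close>.\<close>

lemma AE_fst_in_sample: "AE z in \<pi>. fst z \<in> x ` {1..N}"
proof -
  have "AE a in distr \<pi> (borel_of T) fst. a \<in> x ` {1..N}"
    unfolding fst_marginal using N x
    by (intro AE_empirical_measure) (auto simp: T_def intro!: singleton_in_sets_borel_of_metric)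
  then show ?thesis
    by (rule AE_distrD[rotated]) measurable
qed

text \<open>The integrand depends on the first coordinate alone, so the integral is an average over
  the sample. Every index thus carries the same mass, also when atoms coincide.\<close>

lemma nn_integral_atom_weight:
  assumes "i \<in> {1..N}"
  shows "(\<integral>\<^sup>+ z. atom_weight N x i (fst z) \<partial>\<pi>) = 1 / of_nat N"
proof -
  have "(\<integral>\<^sup>+ z. atom_weight N x i (fst z) \<partial>\<pi>) = (\<integral>\<^sup>+ a. atom_weight N x i a \<partial>distr \<pi> (borel_of T) fst)"
    using assms by (intro nn_integral_distr[symmetric]) measurable
  also have "\<dots> = (\<Sum>j=1..N. atom_weight N x i (x j) / of_nat N)"
    unfolding fst_marginal using N x assms
    by (intro nn_integral_empirical_measure) (auto simp: T_def[symmetric], simp add: T_def)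
  also have "\<dots> = 1 / of_nat N"
    using sum_atom_weight_sample[OF assms, of x]
    by (simp add: divide_ennreal_def sum_distrib_right[symmetric] del: One_nat_def)
  finally show ?thesis .
qed

text \<open>The second marginal survives because the weights sum to one almost everywhere; the first
  becomes the empirical measure at \<open>y\<close> because each index carries mass
  \<open>1 / N\<close>.\<close>

lemma move_atoms_coupling: "move_atoms S N x y \<pi> \<in> couplings S (empirical_measure (borel_of T) N y) P"
proof -
  let ?M = "move_atoms S N x y \<pi>"
  have [measurable_cong]: "sets ?M = sets (borel_of TT)"
    by (simp add: move_atoms_def TT_def)
  have snd: "distr ?M (borel_of T) snd = P"
  proof (rule measure_eqI)
    fix A assume "A \<in> sets (distr ?M (borel_of T) snd)"
    then have A [measurable]: "A \<in> sets (borel_of T)" by simp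
    have "emeasure (distr ?M (borel_of T) snd) A = (\<integral>\<^sup>+ a. indicator A a \<partial>distr ?M (borel_of T) snd)"
      using A by simp
    also have "\<dots> = (\<integral>\<^sup>+ z. indicator A (snd z) \<partial>?M)"
      by (rule nn_integral_distr) measurable
    also have "\<dots> = (\<integral>\<^sup>+ z. (\<Sum>i=1..N. atom_weight N x i (fst z) * indicator A (snd (y i, snd z))) \<partial>\<pi>)"
      by (rule nn_integral_move_atoms) measurable
    also have "\<dots> = (\<integral>\<^sup>+ z. indicator A (snd z) \<partial>\<pi>)"
      by (rule nn_integral_cong_AE, use AE_fst_in_sample in eventually_elim)
         (simp add: sum_distrib_right[symmetric] sum_atom_weight del: One_nat_def)
    also have "\<dots> = (\<integral>\<^sup>+ a. indicator A a \<partial>distr \<pi> (borel_of T) snd)"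
      by (rule nn_integral_distr[symmetric]) measurable
    also have "\<dots> = emeasure P A"
      using A snd_marginal[symmetric] by simp
    finally show "emeasure (distr ?M (borel_of T) snd) A = emeasure P A" .
  qed (simp flip: snd_marginal)
  have fst: "distr ?M (borel_of T) fst = empirical_measure (borel_of T) N y"
  proof (rule measure_eqI)
    fix A assume "A \<in> sets (distr ?M (borel_of T) fst)"
    then have A [measurable]: "A \<in> sets (borel_of T)" by simp
    have "emeasure (distr ?M (borel_of T) fst) A = (\<integral>\<^sup>+ a. indicator A a \<partial>distr ?M (borel_of T) fst)"
      using A by simp
    also have "\<dots> = (\<integral>\<^sup>+ z. indicator A (fst z) \<partial>?M)"
      by (rule nn_integral_distr) measurable
    also have "\<dots> = (\<integral>\<^sup>+ z. (\<Sum>i=1..N. atom_weight N x i (fst z) * indicator A (fst (y i, snd z))) \<partial>\<pi>)"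
      by (rule nn_integral_move_atoms) measurable
    also have "\<dots> = (\<Sum>i=1..N. (\<integral>\<^sup>+ z. atom_weight N x i (fst z) * indicator A (y i) \<partial>\<pi>))"
      by (subst nn_integral_sum[symmetric]) auto
    also have "\<dots> = (\<Sum>i=1..N. indicator A (y i) / of_nat N)"
      by (intro sum.cong refl, subst nn_integral_multc)
         (auto simp: nn_integral_atom_weight ennreal_divide_times)
    also have "\<dots> = (\<integral>\<^sup>+ a. indicator A a \<partial>empirical_measure (borel_of T) N y)"
      using N y by (intro nn_integral_empirical_measure[symmetric]) (auto simp: T_def[symmetric], simp add: T_def)
    also have "\<dots> = emeasure (empirical_measure (borel_of T) N y) A"
      using A by simp
    finally show "emeasure (distr ?M (borel_of T) fst) A = emeasure (empirical_measure (borel_of T) N y) A" .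
  qed simp
  \<comment> \<open>Total mass passes from \<open>\<pi>\<close> to its second marginal
    \<open>P\<close>, and from there back to \<open>?M\<close>, which has the same second
    marginal.\<close>
  have "prob_space P"
    unfolding snd_marginal[symmetric] by (rule prob_space.prob_space_distr[OF prob_\<pi>]) measurable
  then have "prob_space ?M"
    unfolding snd[symmetric] by (rule prob_space_distrD[rotated]) measurable
  with fst snd show ?thesis
    by (auto simp: couplings_def borel_probs_def T_def TT_def move_atoms_def)
qed

text \<open>The \<open>i\<close>th weight vanishes unless \<open>fst z = x i\<close>, and there the
  triangle inequality through \<open>x i\<close> costs at most \<open>\<delta>\<close>. The bound no
  longer depends on \<open>i\<close>, so the weights sum out.\<close>

lemma cost_move_atoms:
  assumes p: "1 \<le> p" and close: "\<And>i. i \<in> {1..N} \<Longrightarrow> mdist S (x i) (y i) \<le> \<delta>"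
  shows "(\<integral>\<^sup>+ z. ennreal (mdist S (fst z) (snd z) powr p) \<partial>move_atoms S N x y \<pi>)
    \<le> (\<integral>\<^sup>+ z. ennreal ((\<delta> + mdist S (fst z) (snd z)) powr p) \<partial>\<pi>)"
proof -
  have [measurable]: "(\<lambda>z. mdist S (fst z) (snd z)) \<in> borel_measurable (borel_of TT)"
    by (auto simp: TT_def intro!: continuous_map_borel_measurable continuous_map_mdist
        continuous_map_fst continuous_map_snd)
  have "(\<integral>\<^sup>+ z. ennreal (mdist S (fst z) (snd z) powr p) \<partial>move_atoms S N x y \<pi>)
      = (\<integral>\<^sup>+ z. (\<Sum>i=1..N. atom_weight N x i (fst z) *
          ennreal (mdist S (fst (y i, snd z)) (snd (y i, snd z)) powr p)) \<partial>\<pi>)"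
    by (rule nn_integral_move_atoms) measurable
  also have "\<dots> \<le> (\<integral>\<^sup>+ z. (\<Sum>i=1..N. atom_weight N x i (fst z) *
          ennreal ((\<delta> + mdist S (fst z) (snd z)) powr p)) \<partial>\<pi>)"
  proof (intro nn_integral_mono sum_mono)
    fix z i assume z: "z \<in> space \<pi>" and i: "i \<in> {1..N}"
    have "space \<pi> = mspace S \<times> mspace S"
      using sets_eq_imp_space_eq[OF sets_\<pi>] by (simp add: TT_def)
    then have z: "snd z \<in> mspace S"
      using z by (simp add: mem_Times_iff)
    show "atom_weight N x i (fst z) * ennreal (mdist S (fst (y i, snd z)) (snd (y i, snd z)) powr p)
      \<le> atom_weight N x i (fst z) * ennreal ((\<delta> + mdist S (fst z) (snd z)) powr p)"
    proof (cases "fst z = x i")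
      case True
      have "mdist S (y i) (snd z) \<le> mdist S (y i) (x i) + mdist S (x i) (snd z)"
        using x y i z by (intro mdist_triangle) auto
      then have "mdist S (y i) (snd z) \<le> \<delta> + mdist S (fst z) (snd z)"
        using close[OF i] True by (simp add: mdist_commute)
      then show ?thesis
        using p by (intro mult_left_mono ennreal_leI powr_mono2) auto
    qed (auto simp: atom_weight_def)
  qed
  also have "\<dots> = (\<integral>\<^sup>+ z. ennreal ((\<delta> + mdist S (fst z) (snd z)) powr p) \<partial>\<pi>)"
    by (rule nn_integral_cong_AE, use AE_fst_in_sample in eventually_elim)
       (simp add: sum_distrib_right[symmetric] sum_atom_weight del: One_nat_def)
  finally show ?thesis .
qed

end

end

section \<open>Upper semicontinuity of the transport cost and measurability of the ball
  event\<close>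

text \<open>Along the shifts \<open>1 / (m + 1)\<close> the integrals decrease to the unshifted one
  by monotone convergence from above, so the strict inequality already holds for some
  \<open>m\<close>.\<close>

lemma shifted_powr_integral_less:
  fixes f :: "'a \<Rightarrow> real"
  assumes "prob_space M" and f [measurable]: "f \<in> borel_measurable M" and nonneg: "\<And>z. 0 \<le> f z"
    and p: "1 \<le> p" and less: "(\<integral>\<^sup>+ z. ennreal (f z powr p) \<partial>M) < c"
  obtains \<delta> where "0 < \<delta>" "(\<integral>\<^sup>+ z. ennreal ((\<delta> + f z) powr p) \<partial>M) < c"
proof -
  interpret prob_space M by fact
  define g where "g m z = ennreal ((1 / real (Suc m) + f z) powr p)" for m z
  have g_meas: "g m \<in> borel_measurable M" for m
    unfolding g_def by measurable
  have dec: "decseq g"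
    unfolding g_def using p nonneg
    by (intro decseq_SucI le_funI ennreal_leI powr_mono2 add_right_mono divide_left_mono) auto
  \<comment> \<open>Monotone convergence from above needs a finite starting value. It comes from
    \<open>1 + f z \<le> 2 * max 1 (f z)\<close> and from \<open>less\<close>, which makes the
    unshifted integral finite.\<close>
  have "(\<integral>\<^sup>+ z. g 0 z \<partial>M) \<le> (\<integral>\<^sup>+ z. ennreal (2 powr p) * (1 + ennreal (f z powr p)) \<partial>M)"
  proof (rule nn_integral_mono)
    fix z
    have "(1 + f z) powr p \<le> (2 * max 1 (f z)) powr p"
      using p nonneg[of z] by (intro powr_mono2) auto
    also have "\<dots> = 2 powr p * max 1 (f z) powr p"
      by (simp add: powr_mult)
    also have "\<dots> \<le> 2 powr p * (1 + f z powr p)"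
      by (intro mult_left_mono) (auto simp: max_def)
    finally show "g 0 z \<le> ennreal (2 powr p) * (1 + ennreal (f z powr p))"
      by (simp add: g_def ennreal_leI flip: ennreal_mult ennreal_plus ennreal_1)
  qed
  also have "\<dots> = ennreal (2 powr p) * (1 + (\<integral>\<^sup>+ z. ennreal (f z powr p) \<partial>M))"
    by (simp add: nn_integral_cmult nn_integral_add emeasure_space_1)
  also have "\<dots> < \<infinity>"
    using less by (auto simp: ennreal_mult_less_top intro: less_le_trans[OF _ top_greatest])
  finally have fin: "(\<integral>\<^sup>+ z. g 0 z \<partial>M) < \<infinity>" .
  have "(INF m. g m z) = ennreal (f z powr p)" for z
  proof (rule LIMSEQ_unique)
    show "(\<lambda>m. g m z) \<longlonglongrightarrow> (INF m. g m z)"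
      using dec by (intro LIMSEQ_INF decseq_SucI) (metis decseq_Suc_iff le_funD)
    have "(\<lambda>m. 1 / real (Suc m) + f z) \<longlonglongrightarrow> 0 + f z"
      by (intro tendsto_add tendsto_const LIMSEQ_Suc lim_1_over_n)
    \<comment> \<open>\<open>f z\<close> may be 0; \<open>powr\<close> is still continuous there
      from the right because the exponent is positive.\<close>
    then have "(\<lambda>m. (1 / real (Suc m) + f z) powr p) \<longlonglongrightarrow> (0 + f z) powr p"
      using p nonneg[of z] by (intro tendsto_powr2) auto
    then show "(\<lambda>m. g m z) \<longlonglongrightarrow> ennreal (f z powr p)"
      unfolding g_def by (intro tendsto_ennrealI) simp
  qed
  then have "(INF m. integral\<^sup>N M (g m)) = (\<integral>\<^sup>+ z. ennreal (f z powr p) \<partial>M)"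
    using nn_integral_monotone_convergence_INF_decseq[OF dec g_meas fin] by simp
  then have "(INF m. integral\<^sup>N M (g m)) < c"
    using less by simp
  then obtain m where "integral\<^sup>N M (g m) < c"
    by (auto simp: INF_less_iff)
  then show thesis
    by (intro that[of "1 / real (Suc m)"]) (auto simp: g_def[abs_def])
qed

text \<open>Strictness supplies a coupling with cost below \<open>c\<close> even if the infimum is
  not attained, and leaves room for a slack \<open>\<delta>\<close>. Its moved versions then serve
  all samples in the box of \<open>\<delta>\<close>-balls around the atoms.\<close>

lemma openin_transport_cost_less:
  assumes p: "1 \<le> p" and N: "1 \<le> N"
  shows "openin (product_topology (\<lambda>_. mtopology_of S) {1..N})
    {x \<in> topspace (product_topology (\<lambda>_. mtopology_of S) {1..N}).
      (INF \<pi>\<in>couplings S (empirical_measure (borel_of (mtopology_of S)) N x) P.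
        \<integral>\<^sup>+ z. ennreal (mdist S (fst z) (snd z) powr p) \<partial>\<pi>) < c}"
    (is "openin ?X {x \<in> _. ?I x < c}")
proof (subst openin_subopen, safe)
  fix x assume x: "x \<in> topspace ?X" and "?I x < c"
  then obtain \<pi> where \<pi>: "\<pi> \<in> couplings S (empirical_measure (borel_of (mtopology_of S)) N x) P"
    and less: "(\<integral>\<^sup>+ z. ennreal (mdist S (fst z) (snd z) powr p) \<partial>\<pi>) < c"
    by (auto simp: INF_less_iff)
  have sets_\<pi>: "sets \<pi> = sets (borel_of (prod_topology (mtopology_of S) (mtopology_of S)))"
    and prob: "prob_space \<pi>"
    using \<pi> by (auto simp: couplings_def borel_probs_def)
  have "(\<lambda>z. mdist S (fst z) (snd z)) \<in> borel_measurable (borel_of (prod_topology (mtopology_of S) (mtopology_of S)))"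
    by (auto intro!: continuous_map_borel_measurable continuous_map_mdist
        continuous_map_fst continuous_map_snd)
  then have "(\<lambda>z. mdist S (fst z) (snd z)) \<in> borel_measurable \<pi>"
    using measurable_cong_sets[OF sets_\<pi> refl] by blast
  from shifted_powr_integral_less[OF prob this mdist_nonneg p less]
  obtain \<delta> where \<delta>: "0 < \<delta>" "(\<integral>\<^sup>+ z. ennreal ((\<delta> + mdist S (fst z) (snd z)) powr p) \<partial>\<pi>) < c"
    by blast
  let ?V = "Pi\<^sub>E {1..N} (\<lambda>i. mball_of S (x i) \<delta>)"
  have xS: "x i \<in> mspace S" if "i \<in> {1..N}" for i
    using x that by (auto simp: PiE_iff)
  have "openin ?X ?V"
    by (simp add: openin_PiE_gen)
  moreover have "x \<in> ?V"
    using x xS \<delta> by (auto simp: PiE_iff)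
  moreover have "?I y < c" if "y \<in> ?V" for y
  proof -
    have y: "y i \<in> mspace S" "mdist S (x i) (y i) \<le> \<delta>" if "i \<in> {1..N}" for i
      using \<open>y \<in> ?V\<close> that by (auto simp: PiE_iff intro: less_imp_le)
    have "?I y \<le> (\<integral>\<^sup>+ z. ennreal (mdist S (fst z) (snd z) powr p) \<partial>move_atoms S N x y \<pi>)"
      using move_atoms_coupling[OF N xS y(1) sets_\<pi> \<pi>] by (intro INF_lower) auto
    also have "\<dots> \<le> (\<integral>\<^sup>+ z. ennreal ((\<delta> + mdist S (fst z) (snd z)) powr p) \<partial>\<pi>)"
      by (rule cost_move_atoms[OF N xS y(1) sets_\<pi> \<pi> p y(2)])
    finally show ?thesis using \<delta>(2) by simp
  qed
  moreover have "?V \<subseteq> topspace ?X"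
    by (auto simp: PiE_iff)
  ultimately show "\<exists>V. openin ?X V \<and> x \<in> V \<and> V \<subseteq> {x \<in> topspace ?X. ?I x < c}"
    by blast
qed

text \<open>Open strict sublevel sets make the optimal cost Borel, and separability places these
  sets in the product sigma-algebra. The moment condition concerns \<open>P\<close> alone and is
  constant in the sample.\<close>

lemma wasserstein_ball_empirical_measurable:
  assumes p: "1 \<le> p" and N: "1 \<le> N" and S: "separable_space (mtopology_of S)"
  shows "{x \<in> space (PiM {1..N} (\<lambda>_. borel_of (mtopology_of S))).
      P \<in> wasserstein_ball p S (empirical_measure (borel_of (mtopology_of S)) N x) \<epsilon>}
    \<in> sets (PiM {1..N} (\<lambda>_. borel_of (mtopology_of S)))"
proof -
  let ?M = "PiM {1..N} (\<lambda>_. borel_of (mtopology_of S))"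
  define I where "I x = (INF \<pi>\<in>couplings S (empirical_measure (borel_of (mtopology_of S)) N x) P.
        \<integral>\<^sup>+ z. ennreal (mdist S (fst z) (snd z) powr p) \<partial>\<pi>)" for x
  have [measurable]: "I \<in> borel_measurable ?M"
  proof (rule borel_measurableI_less)
    fix c
    have "{x \<in> space ?M. I x < c} \<in> sets (borel_of (product_topology (\<lambda>_. mtopology_of S) {1..N}))"
      using openin_in_sets_borel_of[OF openin_transport_cost_less[OF p N, of S P c]]
      by (simp add: I_def space_PiM)
    then show "{x \<in> space ?M. I x < c} \<in> sets ?M"
      by (simp add: sets_borel_of_product_topology separable_metric_imp_second_countable S)
  qed
  have "{x \<in> space ?M. P \<in> borel_probs_moment p S \<and> enn2real (I x) powr (1 / p) \<le> \<epsilon>} \<in> sets ?M"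
    by measurable
  then show ?thesis
    by (simp add: wasserstein_ball_def wasserstein_def I_def)
qed

section \<open>From independent rows to independent columns\<close>

text \<open>Independent rows with independent entries make the whole array independent, and grouping
  its indices by \<open>k\<close> gives the columns. Row independence enters as a product formula so
  that it transfers between sigma-algebras with the same sets.\<close>

lemma (in prob_space) indep_vars_components:
  assumes I: "finite I" "I \<noteq> {}" and K: "finite K" "K \<noteq> {}"
    and rv: "\<And>i k. i \<in> I \<Longrightarrow> k \<in> K \<Longrightarrow> random_variable (B k) (\<lambda>\<omega>. X i \<omega> k)"
    and rows: "\<And>A. (\<And>i. i \<in> I \<Longrightarrow> A i \<in> sets (PiM K B)) \<Longrightarrow>
      prob (\<Inter>i\<in>I. X i -` A i \<inter> space M) = (\<Prod>i\<in>I. prob (X i -` A i \<inter> space M))"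
    and ext: "\<And>i \<omega>. i \<in> I \<Longrightarrow> \<omega> \<in> space M \<Longrightarrow> X i \<omega> \<in> extensional K"
    and comps: "\<And>i. i \<in> I \<Longrightarrow> indep_vars B (\<lambda>k \<omega>. X i \<omega> k) K"
  shows "indep_vars (\<lambda>k. PiM I (\<lambda>_. B k)) (\<lambda>k \<omega>. \<lambda>i\<in>I. X i \<omega> k) K"
proof -
  have indep: "indep_vars (\<lambda>(i, k). B k) (\<lambda>(i, k) \<omega>. X i \<omega> k) (I \<times> K)"
  \<comment> \<open>Over a finite index set the product formula for the full family suffices, since
    individual test sets may be the whole space.\<close>
  proof (subst indep_vars_finite[where E = "\<lambda>(i, k). sets (B k)"])
    show "\<forall>A\<in>(\<Pi> j\<in>I \<times> K. (case j of (i, k) \<Rightarrow> sets (B k))).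
      prob (\<Inter>j\<in>I \<times> K. (case j of (i, k) \<Rightarrow> \<lambda>\<omega>. X i \<omega> k) -` A j \<inter> space M) =
      (\<Prod>j\<in>I \<times> K. prob ((case j of (i, k) \<Rightarrow> \<lambda>\<omega>. X i \<omega> k) -` A j \<inter> space M))"
    proof
      fix A assume A: "A \<in> (\<Pi> j\<in>I \<times> K. (case j of (i, k) \<Rightarrow> sets (B k)))"
      then have A: "A (i, k) \<in> sets (B k)" if "i \<in> I" "k \<in> K" for i k
        using that by (auto simp: Pi_iff)
      \<comment> \<open>The box gathers the tests on row \<open>i\<close> into a single event;
        \<open>ext\<close> ensures that membership means just the coordinate conditions.\<close>
      define R where "R i = Pi\<^sub>E K (\<lambda>k. A (i, k))" for i
      have R: "R i \<in> sets (PiM K B)" if "i \<in> I" for i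
        unfolding R_def using A K that by (intro sets_PiM_I_finite) auto
      have vimage_R: "X i -` R i \<inter> space M = (\<Inter>k\<in>K. (\<lambda>\<omega>. X i \<omega> k) -` A (i, k) \<inter> space M)"
        if "i \<in> I" for i
        using K ext[OF that] by (auto simp: R_def PiE_iff)
      have "(\<Inter>j\<in>I \<times> K. (case j of (i, k) \<Rightarrow> \<lambda>\<omega>. X i \<omega> k) -` A j \<inter> space M)
          = (\<Inter>i\<in>I. X i -` R i \<inter> space M)"
        using I K by (auto simp: vimage_R)
      then have "prob (\<Inter>j\<in>I \<times> K. (case j of (i, k) \<Rightarrow> \<lambda>\<omega>. X i \<omega> k) -` A j \<inter> space M)
          = (\<Prod>i\<in>I. prob (X i -` R i \<inter> space M))"
        using rows[OF R] by simp
      also have "\<dots> = (\<Prod>i\<in>I. \<Prod>k\<in>K. prob ((\<lambda>\<omega>. X i \<omega> k) -` A (i, k) \<inter> space M))"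
        using A K by (intro prod.cong refl) (simp only: vimage_R, intro indep_varsD_finite[OF comps], auto)
      also have "\<dots> = (\<Prod>j\<in>I \<times> K. prob ((case j of (i, k) \<Rightarrow> \<lambda>\<omega>. X i \<omega> k) -` A j \<inter> space M))"
        by (simp add: prod.cartesian_product case_prod_unfold)
      finally show "prob (\<Inter>j\<in>I \<times> K. (case j of (i, k) \<Rightarrow> \<lambda>\<omega>. X i \<omega> k) -` A j \<inter> space M) =
        (\<Prod>j\<in>I \<times> K. prob ((case j of (i, k) \<Rightarrow> \<lambda>\<omega>. X i \<omega> k) -` A j \<inter> space M))" .
    qed
  qed (use I K rv in \<open>auto simp: sets.sigma_sets_eq sets.Int_stable dest: sets.sets_into_space\<close>)
  \<comment> \<open>The blocks \<open>I \<times> {k}\<close> are disjoint, so the restrictions of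
    the array to them are independent; a measurable reindexing from \<open>I \<times> {k}\<close> to
    \<open>I\<close> then yields the columns.\<close>
  have "indep_vars (\<lambda>k. PiM (I \<times> {k}) (\<lambda>(i, k). B k))
      (\<lambda>k \<omega>. \<lambda>j\<in>I \<times> {k}. (\<lambda>(i, k) \<omega>. X i \<omega> k) j \<omega>) K"
    by (rule indep_vars_restrict[OF indep]) (auto simp: disjoint_family_on_def)
  then have "indep_vars (\<lambda>k. PiM I (\<lambda>_. B k))
      (\<lambda>k. (\<lambda>f. \<lambda>i\<in>I. f (i, k)) \<circ> (\<lambda>\<omega>. \<lambda>j\<in>I \<times> {k}. (\<lambda>(i, k) \<omega>. X i \<omega> k) j \<omega>)) K"
  proof (rule indep_vars_compose)
    fix k assume "k \<in> K"
    have "(\<lambda>f. f (i, k)) \<in> measurable (PiM (I \<times> {k}) (\<lambda>(i, k). B k)) (B k)" if "i \<in> I" for i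
      using measurable_component_singleton[of "(i, k)" "I \<times> {k}" "\<lambda>(i, k). B k"] that by simp
    then show "(\<lambda>f. \<lambda>i\<in>I. f (i, k)) \<in> measurable (PiM (I \<times> {k}) (\<lambda>(i, k). B k)) (PiM I (\<lambda>_. B k))"
      by (intro measurable_restrict)
  qed
  moreover have "(\<lambda>f. \<lambda>i\<in>I. f (i, k)) \<circ> (\<lambda>\<omega>. \<lambda>j\<in>I \<times> {k}. (\<lambda>(i, k) \<omega>. X i \<omega> k) j \<omega>)
      = (\<lambda>\<omega>. \<lambda>i\<in>I. X i \<omega> k)" for k
    by (auto simp: fun_eq_iff)
  ultimately show ?thesis by simp
qed

section \<open>The hyperrectangle event as an intersection of independent ball events\<close>

theorem theorem4p1:
  fixes p :: real and n N :: nat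
    and \<Xi> :: "nat \<Rightarrow> 'a metric"
    and \<rho> :: "(nat \<Rightarrow> 'a) metric"
    and \<Omega>' :: "'v measure" and \<xi> :: "'v \<Rightarrow> nat \<Rightarrow> 'a"
    and \<Omega> :: "'w measure" and X :: "nat \<Rightarrow> 'w \<Rightarrow> nat \<Rightarrow> 'a"
    and \<epsilon> \<beta> :: "nat \<Rightarrow> real"
  defines "B \<equiv> \<lambda>k. borel_of (mtopology_of (\<Xi> k))"
    and "P\<xi> \<equiv> distr \<Omega>' (borel_of (mtopology_of \<rho>)) \<xi>"
    and "P\<xi>c \<equiv> \<lambda>k. distr \<Omega>' (borel_of (mtopology_of (\<Xi> k))) (\<lambda>\<omega>. \<xi> \<omega> k)"
    and "PN \<equiv> \<lambda>\<omega> k. empirical_measure (borel_of (mtopology_of (\<Xi> k))) N (\<lambda>i. X i \<omega> k)"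
  assumes p: "1 \<le> p" and n: "1 \<le> n" and N: "1 \<le> N"
    and polish_factors: "\<And>k. k \<in> {1..n} \<Longrightarrow> polish_metric (\<Xi> k)"
    and polish_product: "polish_metric \<rho>"
    and product: "mtopology_of \<rho> = product_topology (\<lambda>k. mtopology_of (\<Xi> k)) {1..n}"
    and \<xi>_space: "prob_space \<Omega>'"
    and \<xi>_rv: "\<xi> \<in> measurable \<Omega>' (borel_of (mtopology_of \<rho>))"
    and \<xi>_indep: "prob_space.indep_vars \<Omega>' B (\<lambda>k \<omega>. \<xi> \<omega> k) {1..n}"
    and \<xi>_moment: "P\<xi> \<in> borel_probs_moment p \<rho>"
    and X_space: "prob_space \<Omega>"
    and X_indep: "prob_space.indep_vars \<Omega> (\<lambda>i. borel_of (mtopology_of \<rho>)) X {1..N}"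
    and X_distr: "\<And>i. i \<in> {1..N} \<Longrightarrow> distr \<Omega> (borel_of (mtopology_of \<rho>)) (X i) = P\<xi>"
    and \<epsilon>: "\<And>k. k \<in> {1..n} \<Longrightarrow> 0 < \<epsilon> k"
    and \<beta>: "\<And>k. k \<in> {1..n} \<Longrightarrow> 0 \<le> \<beta> k \<and> \<beta> k \<le> 1"
    and confidence: "\<And>k. k \<in> {1..n} \<Longrightarrow>
      measure \<Omega> {\<omega> \<in> space \<Omega>. P\<xi>c k \<in> wasserstein_ball p (\<Xi> k) (PN \<omega> k) (\<epsilon> k)} \<ge> 1 - \<beta> k"
  shows "measure \<Omega> {\<omega> \<in> space \<Omega>. P\<xi> \<in> wasserstein_hyperrectangle p n \<Xi> (PN \<omega>) \<epsilon>}
           \<ge> (\<Prod>k=1..n. 1 - \<beta> k)"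
proof -
  interpret \<Omega>': prob_space \<Omega>' by (rule \<xi>_space)
  interpret \<Omega>: prob_space \<Omega> by (rule X_space)
  let ?K = "{1..n}" and ?I = "{1..N}"
  have separable: "separable_space (mtopology_of (\<Xi> k))" if "k \<in> ?K" for k
    using polish_factors[OF that] by (simp add: polish_metric_def)
  \<comment> \<open>This allows \<open>\<xi>\<close> and the samples to be handled as families of
    coordinates under \<open>PiM\<close>.\<close>
  have sets_\<rho>: "sets (borel_of (mtopology_of \<rho>)) = sets (PiM ?K B)"
    unfolding product B_def
    by (intro sets_borel_of_product_topology) (auto intro!: separable_metric_imp_second_countable separable)
  have \<xi>_PiM [measurable]: "\<xi> \<in> measurable \<Omega>' (PiM ?K B)"
    using \<xi>_rv measurable_cong_sets[OF refl sets_\<rho>] by blast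
  have X_PiM: "X i \<in> measurable \<Omega> (PiM ?K B)" if "i \<in> ?I" for i
    using X_indep that unfolding \<Omega>.indep_vars_def measurable_cong_sets[OF refl sets_\<rho>] by blast
  have P\<xi>_eq: "P\<xi> = distr \<Omega>' (PiM ?K B) \<xi>"
    unfolding P\<xi>_def by (intro distr_cong sets_\<rho> refl)
  have \<xi>_comp: "(\<lambda>\<omega>. \<xi> \<omega> k) \<in> measurable \<Omega>' (B k)" if "k \<in> ?K" for k
    using measurable_compose[OF \<xi>_PiM measurable_component_singleton[OF that]] .
  have X_comp: "(\<lambda>\<omega>. X i \<omega> k) \<in> measurable \<Omega> (B k)" if "i \<in> ?I" "k \<in> ?K" for i k
    using measurable_compose[OF X_PiM measurable_component_singleton] that by blast
  have ext: "(\<lambda>k\<in>?K. x k) = x" if "x \<in> space (PiM ?K B)" for x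
    using that by (auto simp: space_PiM PiE_iff extensional_restrict)
  have P\<xi>c_eq: "P\<xi>c k = distr \<Omega>' (B k) (\<lambda>\<omega>. \<xi> \<omega> k)" for k
    by (simp add: P\<xi>c_def B_def)
  have prob_P\<xi>c: "prob_space (P\<xi>c k)" if "k \<in> ?K" for k
    unfolding P\<xi>c_eq by (intro \<Omega>'.prob_space_distr \<xi>_comp that)
  \<comment> \<open>Independence of the components says that the joint law is the product of the
    marginals; the values of \<open>\<xi>\<close> are extensional, so the restriction to
    \<open>?K\<close> disappears.\<close>
  have P\<xi>_PiM: "P\<xi> = PiM ?K P\<xi>c"
  proof -
    have "distr \<Omega>' (PiM ?K B) (\<lambda>\<omega>. \<lambda>k\<in>?K. \<xi> \<omega> k) = PiM ?K P\<xi>c"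
      using \<xi>_indep n \<Omega>'.indep_vars_iff_distr_eq_PiM'[of ?K "\<lambda>k \<omega>. \<xi> \<omega> k" B] \<xi>_comp
      by (simp add: P\<xi>c_eq[abs_def])
    moreover have "distr \<Omega>' (PiM ?K B) (\<lambda>\<omega>. \<lambda>k\<in>?K. \<xi> \<omega> k) = P\<xi>"
      unfolding P\<xi>_eq using measurable_space[OF \<xi>_PiM] by (intro distr_cong refl ext) auto
    ultimately show ?thesis by simp
  qed
  \<comment> \<open>Independence of components is assumed for \<open>\<xi>\<close> and inherited by
    each sample, being a property of the common law.\<close>
  have X_comps: "\<Omega>.indep_vars B (\<lambda>k \<omega>. X i \<omega> k) ?K" if i: "i \<in> ?I" for i
  proof -
    have X_law: "distr \<Omega> (PiM ?K B) (X i) = P\<xi>"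
      using X_distr[OF i] distr_cong[OF refl sets_\<rho>, of \<Omega> "X i" "X i"] by simp
    have "distr \<Omega> (PiM ?K B) (\<lambda>\<omega>. \<lambda>k\<in>?K. X i \<omega> k) = distr \<Omega> (PiM ?K B) (X i)"
      using measurable_space[OF X_PiM[OF i]] by (intro distr_cong refl ext) auto
    also have "\<dots> = PiM ?K (\<lambda>k. distr \<Omega> (B k) (\<lambda>\<omega>. X i \<omega> k))"
      unfolding X_law P\<xi>_PiM
    proof (rule PiM_cong)
      fix k assume k: "k \<in> ?K"
      \<comment> \<open>Both marginals are images of the same law \<open>P\<xi>\<close> under the
        \<open>k\<close>th projection.\<close>
      have "P\<xi>c k = distr P\<xi> (B k) (\<lambda>x. x k)"
        unfolding P\<xi>_eq P\<xi>c_eq using k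
        by (subst distr_distr[OF measurable_component_singleton \<xi>_PiM]) (auto simp: comp_def)
      also have "\<dots> = distr \<Omega> (B k) (\<lambda>\<omega>. X i \<omega> k)"
        unfolding X_law[symmetric] using k
        by (subst distr_distr[OF measurable_component_singleton X_PiM[OF i]]) (auto simp: comp_def)
      finally show "P\<xi>c k = distr \<Omega> (B k) (\<lambda>\<omega>. X i \<omega> k)" .
    qed simp
    finally show ?thesis
      using n \<Omega>.indep_vars_iff_distr_eq_PiM'[of ?K "\<lambda>k \<omega>. X i \<omega> k" B] X_comp[OF i] by simp
  qed
  have columns: "\<Omega>.indep_vars (\<lambda>k. PiM ?I (\<lambda>_. B k)) (\<lambda>k \<omega>. \<lambda>i\<in>?I. X i \<omega> k) ?K"
  proof (rule \<Omega>.indep_vars_components)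
    fix A :: "nat \<Rightarrow> (nat \<Rightarrow> 'a) set" assume "\<And>i. i \<in> ?I \<Longrightarrow> A i \<in> sets (PiM ?K B)"
    then show "\<Omega>.prob (\<Inter>i\<in>?I. X i -` A i \<inter> space \<Omega>) = (\<Prod>i\<in>?I. \<Omega>.prob (X i -` A i \<inter> space \<Omega>))"
      using N by (intro \<Omega>.indep_varsD_finite[OF X_indep]) (auto simp: sets_\<rho>)
  next
    fix i \<omega> assume "i \<in> ?I" "\<omega> \<in> space \<Omega>"
    then show "X i \<omega> \<in> extensional ?K"
      using measurable_space[OF X_PiM] by (force simp: space_PiM PiE_iff)
  qed (use n N X_comp X_comps in auto)
  \<comment> \<open>\<open>A k\<close> is a set of columns and \<open>E k\<close> the event in
    \<open>\<Omega>\<close> that the \<open>k\<close>th column lies in it; this carries independence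
    from the columns to the events.\<close>
  define A where "A k = {x \<in> space (PiM ?I (\<lambda>_. B k)).
    P\<xi>c k \<in> wasserstein_ball p (\<Xi> k) (empirical_measure (B k) N x) (\<epsilon> k)}" for k
  define E where "E k = {\<omega> \<in> space \<Omega>. P\<xi>c k \<in> wasserstein_ball p (\<Xi> k) (PN \<omega> k) (\<epsilon> k)}" for k
  have A: "A k \<in> sets (PiM ?I (\<lambda>_. B k))" if "k \<in> ?K" for k
    unfolding A_def B_def by (rule wasserstein_ball_empirical_measurable[OF p N separable[OF that]])
  have E: "E k = (\<lambda>\<omega>. \<lambda>i\<in>?I. X i \<omega> k) -` A k \<inter> space \<Omega>" if "k \<in> ?K" for k
  proof -
    \<comment> \<open>The empirical measure reads its sample only at the indices
      \<open>1..N\<close>, so restricting the column to \<open>?I\<close> changes nothing.\<close>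
    have "empirical_measure (B k) N (\<lambda>i\<in>?I. X i \<omega> k) = PN \<omega> k" for \<omega>
      by (simp add: PN_def B_def empirical_measure_def)
    moreover have "(\<lambda>i\<in>?I. X i \<omega> k) \<in> space (PiM ?I (\<lambda>_. B k))" if "\<omega> \<in> space \<Omega>" for \<omega>
      using measurable_space[OF X_comp[OF _ \<open>k \<in> ?K\<close>] that] by (auto simp: space_PiM)
    ultimately show ?thesis
      unfolding E_def A_def by auto
  qed
  have "{\<omega> \<in> space \<Omega>. P\<xi> \<in> wasserstein_hyperrectangle p n \<Xi> (PN \<omega>) \<epsilon>} = (\<Inter>k\<in>?K. E k)"
  proof -
    have "P\<xi> \<in> wasserstein_hyperrectangle p n \<Xi> (PN \<omega>) \<epsilon> \<longleftrightarrow>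
        (\<forall>k\<in>?K. P\<xi>c k \<in> wasserstein_ball p (\<Xi> k) (PN \<omega> k) (\<epsilon> k))" for \<omega>
    proof
      assume "P\<xi> \<in> wasserstein_hyperrectangle p n \<Xi> (PN \<omega>) \<epsilon>"
      then obtain P' where P': "P\<xi> = PiM ?K P'"
        "\<And>k. k \<in> ?K \<Longrightarrow> P' k \<in> wasserstein_ball p (\<Xi> k) (PN \<omega> k) (\<epsilon> k)"
        by (auto simp: wasserstein_hyperrectangle_def)
      then have prob: "prob_space (P' k)" and sets_P': "sets (P' k) = sets (B k)" if "k \<in> ?K" for k
        using that by (force simp: wasserstein_ball_def borel_probs_moment_def borel_probs_def B_def)+
      \<comment> \<open>Projection to a coordinate sends a product of probability measures to its
        factor, so equal products have equal factors.\<close>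
      have "P\<xi>c k = P' k" if k: "k \<in> ?K" for k
      proof -
        have "P\<xi>c k = distr (PiM ?K P\<xi>c) (P\<xi>c k) (\<lambda>x. x k)"
          using distr_PiM_component[of ?K P\<xi>c k] prob_P\<xi>c k by simp
        also have "\<dots> = distr (PiM ?K P') (P' k) (\<lambda>x. x k)"
          using P'(1) P\<xi>_PiM sets_P'[OF k] by (intro distr_cong) (auto simp: P\<xi>c_eq)
        also have "\<dots> = P' k"
          using distr_PiM_component[of ?K P' k] prob k by simp
        finally show ?thesis .
      qed
      then show "\<forall>k\<in>?K. P\<xi>c k \<in> wasserstein_ball p (\<Xi> k) (PN \<omega> k) (\<epsilon> k)"
        using P'(2) by simp
    \<comment> \<open>Conversely, the true marginals \<open>P\<xi>c\<close> themselves are the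
      witness.\<close>
    qed (auto simp: wasserstein_hyperrectangle_def P\<xi>_PiM)
    \<comment> \<open>\<open>1 \<le> n\<close> matters here: an intersection over no index would be
      \<open>UNIV\<close> instead of \<open>space \<Omega>\<close>.\<close>
    then show ?thesis using n by (auto simp: E_def)
  qed
  also have "\<Omega>.prob (\<Inter>k\<in>?K. E k) = (\<Prod>k\<in>?K. \<Omega>.prob (E k))"
    using \<Omega>.indep_varsD_finite[OF columns, of A] n A by (simp add: E)
  \<comment> \<open>Comparing the products factor by factor requires
    \<open>0 \<le> 1 - \<beta> k\<close>, which is \<open>\<beta> k \<le> 1\<close>.\<close>
  also have "\<dots> \<ge> (\<Prod>k=1..n. 1 - \<beta> k)"
    using \<beta> confidence by (intro prod_mono) (auto simp: E_def)
  finally show ?thesis .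
qed

end
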